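(* There is an absolute constant $K$ such that the following holds. Let $f\in\mathcal F_n$, let $d,n,t\ge 2$ and $s\ge1$, and assume that no circuit of depth $2d+1$ and size at most $Kd(st+n)^2$ over $\bigcup_{a=2}^{s(t+2)+2n+2}\{\neg,\wedge_a,\vee_a\}$ computes $f$. Then $\rho_{F_\forall,d,t}(f)\ge s$, where $F_\forall$ is the set of all $(d-1)$-semifilters $F$ with $v(F)\in V$.
   Context: $\mathcal F_n$ is the set of Boolean functions $\{0,1\}^n\to\{0,1\}$. Circuits over $\bigcup_{a=2}^{r}\{\neg,\wedge_a,\vee_a\}$ have gates labeled by negation or AND/OR of arity between $2$ and $r$; depth is the number of edges on the longest output-to-input path; size is the number of gates. For $f\in\mathcal F_n$ let $V:=f^{-1}(1)$, $U:=f^{-1}(0)$, and for $g\in\mathcal F_n$ let $[[g]]:=g^{-1}(1)\cap U$. Families $F^k\subseteq\mathcal P(U)$ are identified with predicates ($F^k(A)=1$ iff $A\in F^k$). For $e\ge1$, an $e$-semifilter with $v(F)\in V$ is a tuple $F=(F^0,\dots,F^e)$ with $F^0\subseteq F^1\subseteq\dots\subseteq F^e\subseteq\mathcal P(U)$ such that $F^e(\emptyset)=0$, $F^0(U)=1$, and: (initial sets) for each $i\in[n]$, $F^0([[x_i]])\ne F^0([[\neg x_i]])$, and the string $v(F)\in\{0,1\}^n$ with $v(F)_i:=F^0([[x_i]])$ lies in $V$; ($e$-monotonicity) for $1\le k\le e$, if $F^{k-1}(B)=1$ and $B\subseteq A$ then $F^k(A)=1$. For $1\le k\le e$, $F$ $k$-preserves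 a tuple $(A_1,\dots,A_t)$ of subsets of $U$ if $\bigwedge_{i}F^{k-1}(A_i)=1$ implies $F^k(\bigcap_i A_i)=1$; otherwise the tuple $k$-covers $F$. For a set $F_0$ of $(d-1)$-semifilters with $v(F)\in V$ ($d\ge2$), $\rho_{F_0,d,t}(f)$ is the minimal number of tuples $(A_1,\dots,A_t)$ of subsets of $U$ such that for every $F\in F_0$ there exist $1\le k<d$ and one of the tuples that $k$-covers $F$; $\infty$ if no such set of tuples exists. *)

theory Defs
  imports Complex_Main "HOL-Library.Extended_Nat"
begin

section \<open>Boolean functions\<close>

text \<open>Bit strings are lists and coordinates are numbered from 0. A Boolean function of
  \<open>n\<close> variables is a predicate on bit strings of which only the restriction to \<open>cube n\<close>
  is ever used.\<close>

definition cube :: "nat \<Rightarrow> bool list set" where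
  "cube n = {x. length x = n}"

definition ones :: "nat \<Rightarrow> (bool list \<Rightarrow> bool) \<Rightarrow> bool list set" where
  "ones n f = {x \<in> cube n. f x}"

definition zeros :: "nat \<Rightarrow> (bool list \<Rightarrow> bool) \<Rightarrow> bool list set" where
  "zeros n f = {x \<in> cube n. \<not> f x}"

text \<open>\<open>trace n f g\<close> is the set \<open>[[g]]\<close> of the 1-inputs of \<open>g\<close> among the 0-inputs of \<open>f\<close>.\<close>

definition trace :: "nat \<Rightarrow> (bool list \<Rightarrow> bool) \<Rightarrow> (bool list \<Rightarrow> bool) \<Rightarrow> bool list set" where
  "trace n f g = ones n g \<inter> zeros n f"

section \<open>Circuits\<close>

text \<open>A circuit is an acyclic graph presented in topological order: the wires entering a
  gate come from input variables or from gates occurring earlier in the list. Fan-out is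
  unrestricted, and a gate may read the same wire more than once. The second component
  of a circuit is its output.\<close>

datatype wire = Input nat | Gate nat

datatype gate = NotG wire | AndG "wire list" | OrG "wire list"

type_synonym circuit = "gate list \<times> wire"

fun gate_args :: "gate \<Rightarrow> wire list" where
  "gate_args (NotG w) = [w]"
| "gate_args (AndG ws) = ws"
| "gate_args (OrG ws) = ws"

fun in_basis :: "nat \<Rightarrow> gate \<Rightarrow> bool" where
  "in_basis r (NotG w) \<longleftrightarrow> True"
| "in_basis r (AndG ws) \<longleftrightarrow> 2 \<le> length ws \<and> length ws \<le> r"
| "in_basis r (OrG ws) \<longleftrightarrow> 2 \<le> length ws \<and> length ws \<le> r"

fun wire_ok :: "nat \<Rightarrow> nat \<Rightarrow> wire \<Rightarrow> bool" where
  "wire_ok n m (Input i) \<longleftrightarrow> i < n"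
| "wire_ok n m (Gate j) \<longleftrightarrow> j < m"

definition circuit_over :: "nat \<Rightarrow> nat \<Rightarrow> circuit \<Rightarrow> bool" where
  "circuit_over r n C \<longleftrightarrow>
     (\<forall>j < length (fst C). in_basis r (fst C ! j) \<and>
        (\<forall>w \<in> set (gate_args (fst C ! j)). wire_ok n j w)) \<and>
     wire_ok n (length (fst C)) (snd C)"

fun wire_val :: "bool list \<Rightarrow> bool list \<Rightarrow> wire \<Rightarrow> bool" where
  "wire_val x vs (Input i) = x ! i"
| "wire_val x vs (Gate j) = vs ! j"

fun gate_val :: "bool list \<Rightarrow> bool list \<Rightarrow> gate \<Rightarrow> bool" where
  "gate_val x vs (NotG w) \<longleftrightarrow> \<not> wire_val x vs w"
| "gate_val x vs (AndG ws) \<longleftrightarrow> (\<forall>w \<in> set ws. wire_val x vs w)"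
| "gate_val x vs (OrG ws) \<longleftrightarrow> (\<exists>w \<in> set ws. wire_val x vs w)"

definition gate_vals :: "bool list \<Rightarrow> gate list \<Rightarrow> bool list" where
  "gate_vals x gs = foldl (\<lambda>vs g. vs @ [gate_val x vs g]) [] gs"

definition circuit_eval :: "circuit \<Rightarrow> bool list \<Rightarrow> bool" where
  "circuit_eval C x = wire_val x (gate_vals x (fst C)) (snd C)"

definition computes :: "nat \<Rightarrow> circuit \<Rightarrow> (bool list \<Rightarrow> bool) \<Rightarrow> bool" where
  "computes n C f \<longleftrightarrow> (\<forall>x \<in> cube n. circuit_eval C x = f x)"

definition circuit_size :: "circuit \<Rightarrow> nat" where
  "circuit_size C = length (fst C)"

text \<open>\<open>path_to_input gs w m\<close>: some path with exactly \<open>m\<close> edges leads from \<open>w\<close> down to an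
  input variable. For a circuit satisfying \<open>circuit_over\<close> the set in \<open>circuit_depth\<close> is
  finite and nonempty.\<close>

inductive path_to_input :: "gate list \<Rightarrow> wire \<Rightarrow> nat \<Rightarrow> bool" for gs where
  input: "path_to_input gs (Input i) 0"
| gate: "j < length gs \<Longrightarrow> w \<in> set (gate_args (gs ! j)) \<Longrightarrow> path_to_input gs w m
           \<Longrightarrow> path_to_input gs (Gate j) (Suc m)"

definition circuit_depth :: "circuit \<Rightarrow> nat" where
  "circuit_depth C = Max {m. path_to_input (fst C) (snd C) m}"

section \<open>Semifilters\<close>

text \<open>A tuple \<open>(F\<^sup>0, \<dots>, F\<^sup>e)\<close> is given by a sequence of which only the entries \<open>0, \<dots>, e\<close>
  matter. Membership \<open>A \<in> F k\<close> stands for \<open>F\<^sup>k(A) = 1\<close>.\<close>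

type_synonym families = "nat \<Rightarrow> bool list set set"

definition semifilter :: "nat \<Rightarrow> (bool list \<Rightarrow> bool) \<Rightarrow> nat \<Rightarrow> families \<Rightarrow> bool" where
  "semifilter n f e F \<longleftrightarrow>
     (\<forall>k<e. F k \<subseteq> F (Suc k)) \<and> F e \<subseteq> Pow (zeros n f) \<and>
     {} \<notin> F e \<and> zeros n f \<in> F 0 \<and>
     (\<forall>i<n. (trace n f (\<lambda>x. x ! i) \<in> F 0) \<noteq> (trace n f (\<lambda>x. \<not> x ! i) \<in> F 0)) \<and>
     (\<forall>k\<in>{1..e}. \<forall>A B. B \<in> F (k - 1) \<and> B \<subseteq> A \<and> A \<subseteq> zeros n f \<longrightarrow> A \<in> F k)"

definition semifilter_vec :: "nat \<Rightarrow> (bool list \<Rightarrow> bool) \<Rightarrow> families \<Rightarrow> bool list" where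
  "semifilter_vec n f F = map (\<lambda>i. trace n f (\<lambda>x. x ! i) \<in> F 0) [0..<n]"

definition all_semifilters :: "nat \<Rightarrow> (bool list \<Rightarrow> bool) \<Rightarrow> nat \<Rightarrow> families set" where
  "all_semifilters n f e = {F. semifilter n f e F \<and> semifilter_vec n f F \<in> ones n f}"

definition preserves :: "nat \<Rightarrow> families \<Rightarrow> bool list set list \<Rightarrow> bool" where
  "preserves k F As \<longleftrightarrow> ((\<forall>A \<in> set As. A \<in> F (k - 1)) \<longrightarrow> \<Inter> (set As) \<in> F k)"

definition covers :: "nat \<Rightarrow> families \<Rightarrow> bool list set list \<Rightarrow> bool" where
  "covers k F As \<longleftrightarrow> \<not> preserves k F As"

definition covering_set ::
  "nat \<Rightarrow> (bool list \<Rightarrow> bool) \<Rightarrow> families set \<Rightarrow> nat \<Rightarrow> nat \<Rightarrow> bool list set list set \<Rightarrow> bool" where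
  "covering_set n f \<F> d t T \<longleftrightarrow>
     finite T \<and> (\<forall>As \<in> T. length As = t \<and> set As \<subseteq> Pow (zeros n f)) \<and>
     (\<forall>F \<in> \<F>. \<exists>k. 1 \<le> k \<and> k < d \<and> (\<exists>As \<in> T. covers k F As))"

text \<open>The infimum of the empty set in \<open>enat\<close> is \<open>\<infinity>\<close>.\<close>

definition rho :: "nat \<Rightarrow> (bool list \<Rightarrow> bool) \<Rightarrow> families set \<Rightarrow> nat \<Rightarrow> nat \<Rightarrow> enat" where
  "rho n f \<F> d t = Inf {enat (card T) | T. covering_set n f \<F> d t T}"

end

theory Submission
  imports Defs
begin

text \<open>Given a covering set \<open>T\<close> with fewer than \<open>s\<close> tuples, every input \<open>x\<close> generates a growing
  sequence of families: start with \<open>U\<close> and the traces of the literals true at \<open>x\<close>, and at each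
  step close once under supersets and under intersections of the tuples in \<open>T\<close>. Only the sets
  occurring in \<open>T\<close>, their intersections and the traces of literals matter, so \<open>d - 1\<close> steps can be
  carried out by a circuit with one AND layer and one OR layer per step. The circuit accepts iff
  the empty set is generated. If \<open>x \<in> U\<close>, all generated sets contain \<open>x\<close>, so \<open>x\<close> is rejected. If
  \<open>x \<in> V\<close> were rejected, the generated families would extend to a semifilter with vector \<open>x\<close> that
  preserves every tuple of \<open>T\<close>. Different literals may have equal traces, so the initial family
  may contain both traces of one variable; adding these pairs as tuples makes such inputs
  generate the empty set at once.\<close>

section \<open>Circuits built layer by layer\<close>

definition gates_over :: "nat \<Rightarrow> nat \<Rightarrow> gate list \<Rightarrow> bool" where
  "gates_over r n gs \<longleftrightarrow> (\<forall>j < length gs. in_basis r (gs ! j) \<and>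
     (\<forall>w \<in> set (gate_args (gs ! j)). wire_ok n j w))"

text \<open>\<open>circuit_depth\<close> is a \<open>Max\<close>: the existence clause makes the set
  of path lengths nonempty, and the bound makes it finite.\<close>

definition wire_within :: "nat \<Rightarrow> gate list \<Rightarrow> nat \<Rightarrow> wire \<Rightarrow> bool" where
  "wire_within n gs D w \<longleftrightarrow> wire_ok n (length gs) w \<and>
     (\<exists>m. path_to_input gs w m) \<and> (\<forall>m. path_to_input gs w m \<longrightarrow> m \<le> D)"

definition realized :: "nat \<Rightarrow> gate list \<Rightarrow> nat \<Rightarrow> (bool list \<Rightarrow> bool) set" where
  "realized n gs D = {g. \<exists>w. wire_within n gs D w \<and>
     (\<forall>x\<in>cube n. wire_val x (gate_vals x gs) w = g x)}"

text \<open>A single gate list must serve all of \<open>S\<close>, so shared subfunctions are paid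
  for once. Speaking of functions instead of wires avoids gate numbering.\<close>

definition realizable :: "nat \<Rightarrow> nat \<Rightarrow> nat \<Rightarrow> nat \<Rightarrow> (bool list \<Rightarrow> bool) set \<Rightarrow> bool" where
  "realizable r n D m S \<longleftrightarrow>
     (\<exists>gs. gates_over r n gs \<and> length gs \<le> m \<and> S \<subseteq> realized n gs D)"

text \<open>The bound is \<open>card J < r\<close> rather than \<open>card J \<le> r\<close> because one wire is always
  duplicated, which turns a gate of fan-in 1 into one of fan-in 2.\<close>

inductive_set one_gate :: "nat \<Rightarrow> (bool list \<Rightarrow> bool) set \<Rightarrow> (bool list \<Rightarrow> bool) set"
  for r S where
  Not: "g \<in> S \<Longrightarrow> (\<lambda>x. \<not> g x) \<in> one_gate r S"
| Or: "J \<subseteq> S \<Longrightarrow> finite J \<Longrightarrow> J \<noteq> {} \<Longrightarrow> card J < r \<Longrightarrow> (\<lambda>x. \<exists>g\<in>J. g x) \<in> one_gate r S"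
| And: "J \<subseteq> S \<Longrightarrow> finite J \<Longrightarrow> J \<noteq> {} \<Longrightarrow> card J < r \<Longrightarrow> (\<lambda>x. \<forall>g\<in>J. g x) \<in> one_gate r S"

lemma one_gate_mono: "h \<in> one_gate r S \<Longrightarrow> S \<subseteq> S' \<Longrightarrow> h \<in> one_gate r S'"
proof (induction rule: one_gate.induct)
  case (Not g)
  then show ?case by (intro one_gate.Not) blast
next
  case (Or J)
  then show ?case by (intro one_gate.Or) blast+
next
  case (And J)
  then show ?case by (intro one_gate.And) blast+
qed

section \<open>Appending one gate to a gate list\<close>

lemma gate_vals_snoc:
  "gate_vals x (gs @ [g]) = gate_vals x gs @ [gate_val x (gate_vals x gs) g]"
  by (simp add: gate_vals_def)

lemma length_gate_vals [simp]: "length (gate_vals x gs) = length gs"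
  by (induction gs rule: rev_induct) (simp_all add: gate_vals_snoc, simp add: gate_vals_def)

lemma wire_val_snoc:
  "wire_ok n (length gs) w \<Longrightarrow>
     wire_val x (gate_vals x (gs @ [g])) w = wire_val x (gate_vals x gs) w"
  by (cases w) (simp_all add: gate_vals_snoc nth_append)

lemma wire_ok_mono: "wire_ok n j w \<Longrightarrow> j \<le> k \<Longrightarrow> wire_ok n k w"
  by (cases w) auto

lemma path_to_input_snoc:
  "path_to_input gs w m \<Longrightarrow> path_to_input (gs @ [g]) w m"
proof (induction rule: path_to_input.induct)
  case (gate j w m)
  then show ?case
    by (intro path_to_input.gate) (auto simp: nth_append)
qed (rule path_to_input.input)

text \<open>Topological order: a path from an old wire only descends to earlier gates, so it never
  meets the appended one.\<close>

lemma path_to_input_snocD: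
  "path_to_input (gs @ [g]) w m \<Longrightarrow> gates_over r n gs \<Longrightarrow> wire_ok n (length gs) w \<Longrightarrow>
     path_to_input gs w m"
proof (induction rule: path_to_input.induct)
  case (gate j w m)
  then have j: "j < length gs" and w: "w \<in> set (gate_args (gs ! j))"
    by (auto simp: nth_append)
  moreover from gate.prems j w have "wire_ok n (length gs) w"
    unfolding gates_over_def by (meson less_imp_le wire_ok_mono)
  ultimately show ?case using gate by (auto intro: path_to_input.gate)
qed (rule path_to_input.input)

lemma wire_within_snoc:
  assumes "gates_over r n gs" "wire_within n gs D w"
  shows "wire_within n (gs @ [g]) D w"
proof -
  have "wire_ok n (length gs) w" using assms(2) by (simp add: wire_within_def)
  then have "path_to_input (gs @ [g]) w m \<longleftrightarrow> path_to_input gs w m" for m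
    using assms(1) path_to_input_snoc path_to_input_snocD by blast
  with assms(2) show ?thesis
    using wire_ok_mono[of n "length gs" w] by (simp add: wire_within_def)
qed

lemma realized_snoc:
  assumes "gates_over r n gs"
  shows "realized n gs D \<subseteq> realized n (gs @ [g]) D"
proof
  fix h
  assume "h \<in> realized n gs D"
  then obtain w where w: "wire_within n gs D w"
    "\<forall>x\<in>cube n. wire_val x (gate_vals x gs) w = h x"
    by (auto simp: realized_def)
  then have "wire_ok n (length gs) w" by (simp add: wire_within_def)
  with w(2) have "\<forall>x\<in>cube n. wire_val x (gate_vals x (gs @ [g])) w = h x"
    by (simp add: wire_val_snoc)
  with wire_within_snoc[OF assms w(1)] show "h \<in> realized n (gs @ [g]) D"
    unfolding realized_def by blast
qed

lemma realized_mono: "D \<le> D' \<Longrightarrow> realized n gs D \<subseteq> realized n gs D'"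
  unfolding realized_def wire_within_def by fastforce

lemma gate_within:
  assumes gs: "gates_over r n gs" and basis: "in_basis r g" and ne: "gate_args g \<noteq> []"
    and args: "\<And>w. w \<in> set (gate_args g) \<Longrightarrow> wire_within n gs D w"
  shows "gates_over r n (gs @ [g])"
    and "wire_within n (gs @ [g]) (Suc D) (Gate (length gs))"
proof -
  show "gates_over r n (gs @ [g])"
    using gs basis args
    by (auto simp: gates_over_def nth_append less_Suc_eq wire_within_def)
  have within: "wire_within n (gs @ [g]) D w" if "w \<in> set (gate_args g)" for w
    using wire_within_snoc[OF gs args[OF that]] .
  obtain w where w: "w \<in> set (gate_args g)" using ne by (cases "gate_args g") auto
  then obtain m where "path_to_input (gs @ [g]) w m"
    using within wire_within_def by blast
  with w have "path_to_input (gs @ [g]) (Gate (length gs)) (Suc m)"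
    by (auto intro: path_to_input.gate)
  moreover have "m \<le> Suc D" if "path_to_input (gs @ [g]) (Gate (length gs)) m" for m
    using that by cases (use within in \<open>auto simp: wire_within_def\<close>)
  ultimately show "wire_within n (gs @ [g]) (Suc D) (Gate (length gs))"
    by (auto simp: wire_within_def)
qed

lemma gate_realized:
  assumes gs: "gates_over r n gs" and "in_basis r g" "gate_args g \<noteq> []"
    and "\<And>w. w \<in> set (gate_args g) \<Longrightarrow> wire_within n gs D w"
    and "\<And>x. x \<in> cube n \<Longrightarrow> gate_val x (gate_vals x gs) g = h x"
  shows "\<exists>g. gates_over r n (gs @ [g]) \<and> h \<in> realized n (gs @ [g]) (Suc D)"
proof -
  have "wire_val x (gate_vals x (gs @ [g])) (Gate (length gs)) = h x" if "x \<in> cube n" for x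
    using assms(5)[OF that] by (simp add: gate_vals_snoc nth_append)
  with gate_within[OF assms(1-4)] show ?thesis unfolding realized_def by blast
qed

lemma realized_one_gate:
  assumes gs: "gates_over r n gs" and h: "h \<in> one_gate r (realized n gs D)"
  shows "\<exists>g. gates_over r n (gs @ [g]) \<and> h \<in> realized n (gs @ [g]) (Suc D)"
proof -
  \<comment> \<open>AND and OR depend only on the set of values read. One claim about images
    therefore serves both: OR asks whether \<open>True\<close> occurs in the image, AND whether
    \<open>False\<close> does.\<close>
  have wires: "\<exists>ws. 2 \<le> length ws \<and> length ws \<le> r \<and> (\<forall>w\<in>set ws. wire_within n gs D w) \<and>
      (\<forall>x\<in>cube n. wire_val x (gate_vals x gs) ` set ws = (\<lambda>g. g x) ` J)"
    if J: "J \<subseteq> realized n gs D" "finite J" "J \<noteq> {}" "card J < r" for J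
  proof -
    from J(1) have "\<forall>g\<in>J. \<exists>w. wire_within n gs D w \<and>
        (\<forall>x\<in>cube n. wire_val x (gate_vals x gs) w = g x)"
      by (auto simp: realized_def)
    then obtain W where W: "\<forall>g\<in>J. wire_within n gs D (W g) \<and>
        (\<forall>x\<in>cube n. wire_val x (gate_vals x gs) (W g) = g x)"
      by metis
    obtain js where js: "set js = J" "distinct js"
      using finite_distinct_list[OF J(2)] by blast
    then have len: "length js = card J" and ne: "js \<noteq> []"
      using J(3) distinct_card by fastforce+
    have set: "set (W (hd js) # map W js) = W ` J" using js(1) ne by auto
    have "1 \<le> length js" using ne by (cases js) auto
    moreover have "wire_val x (gate_vals x gs) ` W ` J = (\<lambda>g. g x) ` J" if "x \<in> cube n" for x
      unfolding image_image using W that by (intro image_cong) auto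
    ultimately show ?thesis
      using W J(4) len unfolding set[symmetric]
      by (intro exI[of _ "W (hd js) # map W js"]) (auto simp only: set length_Cons length_map)
  qed
  from h show ?thesis
  proof (induction rule: one_gate.induct)
    case (Not g)
    then obtain w where "wire_within n gs D w"
      "\<forall>x\<in>cube n. wire_val x (gate_vals x gs) w = g x"
      by (auto simp: realized_def)
    then show ?case by (intro gate_realized[OF gs, of "NotG w"]) simp_all
  next
    case (Or J)
    then obtain ws where ws: "2 \<le> length ws" "length ws \<le> r" "\<forall>w\<in>set ws. wire_within n gs D w"
      "\<forall>x\<in>cube n. wire_val x (gate_vals x gs) ` set ws = (\<lambda>g. g x) ` J"
      using wires[of J] by metis
    have "(\<exists>w\<in>set ws. wire_val x (gate_vals x gs) w) = (\<exists>g\<in>J. g x)" if "x \<in> cube n" for x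
    proof -
      have "True \<in> wire_val x (gate_vals x gs) ` set ws \<longleftrightarrow> True \<in> (\<lambda>g. g x) ` J"
        using ws(4) that by simp
      then show ?thesis by (simp add: image_iff)
    qed
    with ws(1-3) show ?case by (intro gate_realized[OF gs, of "OrG ws"]) auto
  next
    case (And J)
    then obtain ws where ws: "2 \<le> length ws" "length ws \<le> r" "\<forall>w\<in>set ws. wire_within n gs D w"
      "\<forall>x\<in>cube n. wire_val x (gate_vals x gs) ` set ws = (\<lambda>g. g x) ` J"
      using wires[of J] by metis
    have "(\<forall>w\<in>set ws. wire_val x (gate_vals x gs) w) = (\<forall>g\<in>J. g x)" if "x \<in> cube n" for x
    proof -
      have "False \<in> wire_val x (gate_vals x gs) ` set ws \<longleftrightarrow> False \<in> (\<lambda>g. g x) ` J"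
        using ws(4) that by simp
      then show ?thesis by (simp add: image_iff) blast
    qed
    with ws(1-3) show ?case by (intro gate_realized[OF gs, of "AndG ws"]) auto
  qed
qed

section \<open>Simultaneous realization of sets of functions, layer by layer\<close>

lemma realizable_inputs: "realizable r n 0 0 {\<lambda>x. x ! i |i. i < n}"
proof -
  have "wire_within n [] 0 (Input i)" if "i < n" for i
    using that by (auto simp: wire_within_def intro: path_to_input.input elim: path_to_input.cases)
  then have "(\<lambda>x. x ! i) \<in> realized n [] 0" if "i < n" for i
    using that unfolding realized_def by fastforce
  then show ?thesis
    unfolding realizable_def by (intro exI[of _ "[]"]) (auto simp: gates_over_def)
qed

text \<open>The gates for \<open>H\<close> are appended one after another, but each reads only
  functions of \<open>S\<close>, which stay realized within depth \<open>D\<close>. Hence the whole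
  layer adds just 1 to the depth.\<close>

lemma realizable_layer:
  assumes "realizable r n D m S" "finite H" "H \<subseteq> one_gate r S"
  shows "realizable r n (Suc D) (m + card H) (S \<union> H)"
proof -
  from assms(1) obtain gs where gs: "gates_over r n gs" "length gs \<le> m" "S \<subseteq> realized n gs D"
    by (auto simp: realizable_def)
  have "\<exists>gs'. gates_over r n gs' \<and> length gs' \<le> m + card H \<and> S \<subseteq> realized n gs' D \<and>
      H \<subseteq> realized n gs' (Suc D)"
    using assms(2,3)
  proof (induction rule: finite_induct)
    case empty
    then show ?case using gs by auto
  next
    case (insert h H)
    then obtain gs' where gs': "gates_over r n gs'" "length gs' \<le> m + card H"
      "S \<subseteq> realized n gs' D" "H \<subseteq> realized n gs' (Suc D)"
      by auto
    with insert.prems have "h \<in> one_gate r (realized n gs' D)"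
      by (blast intro: one_gate_mono)
    from realized_one_gate[OF gs'(1) this] obtain g where
      g: "gates_over r n (gs' @ [g])" "h \<in> realized n (gs' @ [g]) (Suc D)"
      by blast
    with gs' realized_snoc[OF gs'(1), of _ g] insert.hyps show ?case
      by (intro exI[of _ "gs' @ [g]"]) (simp, blast)
  qed
  then show ?thesis
    using realized_mono[of D "Suc D" n] unfolding realizable_def by fastforce
qed

lemma realizable_subset: "realizable r n D m S \<Longrightarrow> S' \<subseteq> S \<Longrightarrow> m \<le> m' \<Longrightarrow> realizable r n D m' S'"
  unfolding realizable_def by (meson order_trans)

lemma realizable_circuit:
  assumes "realizable r n D m S" "f \<in> S" and eq: "\<And>x. x \<in> cube n \<Longrightarrow> f x = g x"
  shows "\<exists>C. circuit_over r n C \<and> circuit_depth C \<le> D \<and> circuit_size C \<le> m \<and>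
    computes n C g"
proof -
  from assms(1,2) obtain gs w where gs: "gates_over r n gs" "length gs \<le> m"
    and w: "wire_within n gs D w" "\<forall>x\<in>cube n. wire_val x (gate_vals x gs) w = f x"
    unfolding realizable_def realized_def by blast
  let ?M = "{m. path_to_input gs w m}"
  have "?M \<subseteq> {..D}" "?M \<noteq> {}" using w(1) by (auto simp: wire_within_def)
  then have "Max ?M \<le> D" using finite_subset by (subst Max_le_iff) blast+
  with gs w eq show ?thesis
    by (intro exI[of _ "(gs, w)"])
      (auto simp: circuit_over_def gates_over_def wire_within_def circuit_depth_def
        circuit_size_def computes_def circuit_eval_def)
qed

section \<open>The families generated by an input\<close>

text \<open>Both rules raise the index by one, as monotonicity and preservation do for semifilters.
  Taking \<open>B = A\<close> in the first rule makes the levels grow. Membership is confined to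
  \<open>\<A>\<close> so that, for finite \<open>\<A>\<close>, a circuit can carry one wire per
  set.\<close>

primrec level :: "'a set set \<Rightarrow> 'a set list set \<Rightarrow> 'a set set \<Rightarrow> nat \<Rightarrow> 'a set set" where
  "level \<A> T G 0 = G"
| "level \<A> T G (Suc k) = {A \<in> \<A>. (\<exists>B \<in> level \<A> T G k. B \<subseteq> A) \<or>
     (\<exists>As \<in> T. set As \<subseteq> level \<A> T G k \<and> \<Inter> (set As) = A)}"

definition literal_sets :: "nat \<Rightarrow> (bool list \<Rightarrow> bool) \<Rightarrow> bool list set set" where
  "literal_sets n f = (\<lambda>i. trace n f (\<lambda>x. x ! i)) ` {..<n} \<union> (\<lambda>i. trace n f (\<lambda>x. \<not> x ! i)) ` {..<n}"

definition initial :: "nat \<Rightarrow> (bool list \<Rightarrow> bool) \<Rightarrow> bool list \<Rightarrow> bool list set set" where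
  "initial n f x = insert (zeros n f)
     {A. \<exists>i<n. (x ! i \<and> A = trace n f (\<lambda>x. x ! i)) \<or> (\<not> x ! i \<and> A = trace n f (\<lambda>x. \<not> x ! i))}"

definition clash_pairs :: "nat \<Rightarrow> (bool list \<Rightarrow> bool) \<Rightarrow> bool list set list set" where
  "clash_pairs n f = (\<lambda>i. [trace n f (\<lambda>x. x ! i), trace n f (\<lambda>x. \<not> x ! i)]) ` {..<n}"

text \<open>These are all sets a circuit has to track: the initial ones, the components and
  intersections of the tuples, and \<open>{}\<close>, whose membership is the output.\<close>

definition relevant :: "nat \<Rightarrow> (bool list \<Rightarrow> bool) \<Rightarrow> bool list set list set \<Rightarrow> bool list set set" where
  "relevant n f T = {zeros n f, {}} \<union> literal_sets n f \<union> (\<Union>As\<in>T. set As) \<union> (\<lambda>As. \<Inter> (set As)) ` T"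

lemma level_subset: "G \<subseteq> \<A> \<Longrightarrow> level \<A> T G k \<subseteq> \<A>"
  by (cases k) auto

lemma level_Suc: "G \<subseteq> \<A> \<Longrightarrow> level \<A> T G k \<subseteq> level \<A> T G (Suc k)"
  using level_subset[of G \<A> T k] by auto

lemma level_mono: "G \<subseteq> \<A> \<Longrightarrow> k \<le> l \<Longrightarrow> level \<A> T G k \<subseteq> level \<A> T G l"
  by (rule lift_Suc_mono_le[of "level \<A> T G"]) (rule level_Suc)

text \<open>Supersets and intersections of sets containing \<open>x\<close> contain
  \<open>x\<close>. Together with \<open>initial_point\<close> this shows that inputs in
  \<open>zeros n f\<close> never generate \<open>{}\<close>.\<close>

lemma level_point:
  assumes "\<And>A. A \<in> G \<Longrightarrow> x \<in> A" "A \<in> level \<A> T G k"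
  shows "x \<in> A"
  using assms(2) by (induction k arbitrary: A) (use assms(1) in auto)

lemma initial_point: "x \<in> zeros n f \<Longrightarrow> A \<in> initial n f x \<Longrightarrow> x \<in> A"
  by (auto simp: initial_def trace_def ones_def zeros_def)

lemma initial_subset: "initial n f x \<subseteq> relevant n f T"
  by (auto simp: initial_def relevant_def literal_sets_def)

lemma relevant_subset:
  assumes "\<And>As. As \<in> T \<Longrightarrow> As \<noteq> [] \<and> set As \<subseteq> Pow (zeros n f)"
  shows "relevant n f T \<subseteq> Pow (zeros n f)"
proof -
  \<comment> \<open>Nonemptiness matters: the intersection of an empty tuple would be
    \<open>UNIV\<close>.\<close>
  have "\<Inter> (set As) \<subseteq> zeros n f" if "As \<in> T" for As
    using assms[OF that] by (cases As) auto
  moreover have "(\<Union>As\<in>T. set As) \<subseteq> Pow (zeros n f)" using assms by blast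
  ultimately show ?thesis
    unfolding relevant_def by (auto simp: literal_sets_def trace_def)
qed

text \<open>The sets outside \<open>\<A>\<close> added in the definition of \<open>F\<close> below must not introduce new
  members of \<open>\<A>\<close>; the index shift to \<open>level k\<close> in \<open>F (Suc k)\<close> achieves this.\<close>

lemma uncovered_semifilter:
  fixes n f T
  defines "\<A> \<equiv> relevant n f T"
  defines "G x \<equiv> level \<A> (T \<union> clash_pairs n f) (initial n f x)"
  assumes T: "\<And>As. As \<in> T \<Longrightarrow> As \<noteq> [] \<and> set As \<subseteq> Pow (zeros n f)"
    and x: "x \<in> ones n f" and e: "e \<ge> 1" and empty: "{} \<notin> G x e"
  shows "\<exists>F \<in> all_semifilters n f e. \<forall>k\<in>{1..e}. \<forall>As\<in>T. preserves k F As"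
proof -
  define F where "F k = (case k of 0 \<Rightarrow> G x 0 |
    Suc k \<Rightarrow> G x (Suc k) \<union> {A. A \<subseteq> zeros n f \<and> (\<exists>B\<in>G x k. B \<subseteq> A)})" for k
  have F0: "F 0 = initial n f x" by (simp add: F_def G_def)
  have init: "initial n f x \<subseteq> \<A>" unfolding \<A>_def by (rule initial_subset)
  have G_sub: "G x k \<subseteq> \<A>" for k unfolding G_def by (rule level_subset[OF init])
  have \<A>_sub: "\<A> \<subseteq> Pow (zeros n f)" unfolding \<A>_def using T by (rule relevant_subset)
  have G_mono: "k \<le> l \<Longrightarrow> G x k \<subseteq> G x l" for k l unfolding G_def by (rule level_mono[OF init])
  \<comment> \<open>A superset of a member of level \<open>k\<close> that lies in
    \<open>\<A>\<close> enters level \<open>Suc k\<close> anyway, so inside \<open>\<A>\<close> the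
    extension adds nothing.\<close>
  have F_rel: "A \<in> F k \<longleftrightarrow> A \<in> G x k" if "A \<in> \<A>" for A k
    using that by (cases k) (auto simp: F_def G_def)
  have G_F: "G x k \<subseteq> F k" for k by (cases k) (auto simp: F_def)
  have F_sub: "F k \<subseteq> Pow (zeros n f)" for k
    using G_sub \<A>_sub by (cases k) (auto simp: F_def)
  \<comment> \<open>The witness is \<open>A\<close> itself or, if \<open>A\<close> was added as a
    superset, a set from the previous level lifted by \<open>G_mono\<close>.\<close>
  have F_G: "\<exists>C\<in>G x k. C \<subseteq> A" if "A \<in> F k" for A k
    using that G_mono[of "k - 1" k] by (cases k) (auto simp: F_def)
  have upward: "A \<in> F (Suc k)" if "B \<in> F k" "B \<subseteq> A" "A \<subseteq> zeros n f" for A B k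
  proof -
    from F_G[OF that(1)] obtain C where "C \<in> G x k" "C \<subseteq> B" by blast
    then have "\<exists>C\<in>G x k. C \<subseteq> A" using that(2) by blast
    with that(3) show ?thesis by (simp add: F_def)
  qed
  have "{} \<in> \<A>" by (simp add: \<A>_def relevant_def)
  have true: "x ! i \<Longrightarrow> trace n f (\<lambda>x. x ! i) \<in> initial n f x"
    "\<not> x ! i \<Longrightarrow> trace n f (\<lambda>x. \<not> x ! i) \<in> initial n f x" if "i < n" for i
    using that by (auto simp: initial_def)
  have clash: False if i: "i < n" and "trace n f (\<lambda>x. x ! i) \<in> initial n f x"
    "trace n f (\<lambda>x. \<not> x ! i) \<in> initial n f x" for i
  proof -
    have "trace n f (\<lambda>x. x ! i) \<inter> trace n f (\<lambda>x. \<not> x ! i) = {}"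
      by (auto simp: trace_def ones_def)
    \<comment> \<open>The clash pair puts \<open>{}\<close> into level 1 already, hence into level
      \<open>e\<close>, as \<open>e \<ge> 1\<close>.\<close>
    with that \<open>{} \<in> \<A>\<close> have "{} \<in> G x 1"
      by (auto simp: G_def clash_pairs_def intro!: bexI[of _ "[trace n f (\<lambda>x. x ! i), trace n f (\<lambda>x. \<not> x ! i)]"])
    with G_mono[OF e] empty show False by blast
  qed
  have lit: "trace n f (\<lambda>x. x ! i) \<in> F 0 \<longleftrightarrow> x ! i"
    "trace n f (\<lambda>x. \<not> x ! i) \<in> F 0 \<longleftrightarrow> \<not> x ! i" if "i < n" for i
    using that true clash unfolding F0 by blast+
  have "semifilter n f e F"
    unfolding semifilter_def
  proof (intro conjI allI impI ballI)
    show "F k \<subseteq> F (Suc k)" for k using upward F_sub by blast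
    show "{} \<notin> F e" using F_rel[OF \<open>{} \<in> \<A>\<close>] empty by simp
    show "zeros n f \<in> F 0" by (simp add: F0 initial_def)
    show "(trace n f (\<lambda>x. x ! i) \<in> F 0) \<noteq> (trace n f (\<lambda>x. \<not> x ! i) \<in> F 0)" if "i < n" for i
      using lit[OF that] by simp
    show "A \<in> F k" if "k \<in> {1..e}" "B \<in> F (k - 1) \<and> B \<subseteq> A \<and> A \<subseteq> zeros n f" for k A B
      using that upward[of B "k - 1" A] by auto
  qed (rule F_sub)
  moreover have "semifilter_vec n f F = x"
    using lit(1) x unfolding semifilter_vec_def
    by (intro nth_equalityI) (auto simp: ones_def cube_def)
  moreover have "preserves k F As" if k: "k \<in> {1..e}" and As: "As \<in> T" for k As
    unfolding preserves_def
  proof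
    assume prem: "\<forall>A\<in>set As. A \<in> F (k - 1)"
    \<comment> \<open>A tuple of \<open>T\<close> and its intersection lie in \<open>\<A>\<close>,
      where \<open>F\<close> and \<open>G x\<close> agree; preservation then is the tuple rule of
      \<open>level\<close>.\<close>
    have "set As \<subseteq> \<A>" "\<Inter> (set As) \<in> \<A>" using As by (auto simp: \<A>_def relevant_def)
    with prem F_rel have "set As \<subseteq> G x (k - 1)" by blast
    with As \<open>\<Inter> (set As) \<in> \<A>\<close> have "\<Inter> (set As) \<in> G x (Suc (k - 1))"
      unfolding G_def by auto
    with k G_F[of k] show "\<Inter> (set As) \<in> F k" by auto
  qed
  ultimately show ?thesis using x by (auto simp: all_semifilters_def)
qed

section \<open>The circuit deciding whether the empty set is generated\<close>

text \<open>One layer negates the variables. Then a single gate per set suffices, an OR of the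
  literals whose trace is that set. Distinct literals may have equal traces, so its fan-in can reach
  \<open>2 * n\<close>.\<close>

lemma realizable_initial:
  assumes n: "n \<ge> 1" and r: "2 * n + 2 < r" and "finite \<A>"
  shows "realizable r n 2 (n + card \<A>) ((\<lambda>A x. A \<in> initial n f x) ` \<A>)"
proof -
  let ?pos = "{\<lambda>x. x ! i |i. i < n}"
  let ?neg = "(\<lambda>i x. \<not> x ! i) ` {..<n}"
  let ?L = "?pos \<union> ?neg"
  have "?neg \<subseteq> one_gate r ?pos" by (auto intro!: one_gate.Not)
  from realizable_layer[OF realizable_inputs _ this]
  have lits: "realizable r n 1 n ?L"
    using card_image_le[of "{..<n}" "\<lambda>i x. \<not> x ! i"] by (auto intro: realizable_subset)
  have "(\<lambda>x. A \<in> initial n f x) \<in> one_gate r ?L" for A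
  proof -
    \<comment> \<open>The basis has no constants. The set \<open>zeros n f\<close> needs the
      constant true and a set that is no literal trace needs the constant false; variable 0 and its
      negation give them by OR and AND.\<close>
    let ?c = "{\<lambda>x. x ! 0, \<lambda>x. \<not> x ! 0} :: (bool list \<Rightarrow> bool) set"
    have c: "?c \<subseteq> ?L" "card ?c < r"
      using n r card_insert_le_m1[of 2 "{\<lambda>x. \<not> x ! 0} :: (bool list \<Rightarrow> bool) set" "\<lambda>x. x ! 0"]
      by auto
    let ?J = "(\<lambda>i x. x ! i) ` {i. i < n \<and> A = trace n f (\<lambda>x. x ! i)} \<union>
      (\<lambda>i x. \<not> x ! i) ` {i. i < n \<and> A = trace n f (\<lambda>x. \<not> x ! i)}"
    consider "A = zeros n f" | "A \<noteq> zeros n f" "?J = {}" | "A \<noteq> zeros n f" "?J \<noteq> {}"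
      by blast
    then show ?thesis
    proof cases
      case 1
      have "(\<lambda>x. \<exists>g\<in>?c. g x) \<in> one_gate r ?L" using c by (intro one_gate.Or) auto
      moreover have "(\<lambda>x. \<exists>g\<in>?c. g x) = (\<lambda>x. A \<in> initial n f x)"
        using 1 by (auto simp: initial_def)
      ultimately show ?thesis by simp
    next
      case 2
      have "(\<lambda>x. \<forall>g\<in>?c. g x) \<in> one_gate r ?L" using c by (intro one_gate.And) auto
      moreover have "(\<lambda>x. \<forall>g\<in>?c. g x) = (\<lambda>x. A \<in> initial n f x)"
        using 2 by (auto simp: initial_def)
      ultimately show ?thesis by simp
    next
      case 3
      have "card ?J \<le> card {i. i < n \<and> A = trace n f (\<lambda>x. x ! i)} +
          card {i. i < n \<and> A = trace n f (\<lambda>x. \<not> x ! i)}"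
        by (intro order_trans[OF card_Un_le] add_mono card_image_le) auto
      also have "\<dots> \<le> card {..<n} + card {..<n}" by (intro add_mono card_mono) auto
      finally have "card ?J < r" using r by simp
      then have "(\<lambda>x. \<exists>g\<in>?J. g x) \<in> one_gate r ?L" using 3 by (intro one_gate.Or) auto
      moreover have "(\<lambda>x. \<exists>g\<in>?J. g x) = (\<lambda>x. A \<in> initial n f x)"
      proof
        show "(\<exists>g\<in>?J. g x) = (A \<in> initial n f x)" for x
          unfolding initial_def using 3(1) by (simp add: bex_Un) blast
      qed
      ultimately show ?thesis by simp
    qed
  qed
  then have "(\<lambda>A x. A \<in> initial n f x) ` \<A> \<subseteq> one_gate r ?L" by blast
  from realizable_layer[OF lits _ this] show ?thesis
    using card_image_le[OF \<open>finite \<A>\<close>, of "\<lambda>A x. A \<in> initial n f x"] \<open>finite \<A>\<close>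
    by (auto intro: realizable_subset simp: numeral_2_eq_2)
qed

text \<open>An AND layer tests for each tuple whether all its components are present. An OR layer
  then collects, for each \<open>A\<close>, its subsets in \<open>\<A>\<close> and the tuples with
  intersection \<open>A\<close>.\<close>

lemma realizable_level_Suc:
  assumes fin: "finite \<A>" "finite T"
    and T: "\<And>As. As \<in> T \<Longrightarrow> As \<noteq> [] \<and> length As < r \<and> set As \<subseteq> \<A>"
    and r: "\<And>A. A \<in> \<A> \<Longrightarrow> card {B \<in> \<A>. B \<subseteq> A} + card {As \<in> T. \<Inter> (set As) = A} < r"
    and sub: "\<And>x. G x \<subseteq> \<A>"
    and real: "realizable r n D m ((\<lambda>A x. A \<in> level \<A> T (G x) k) ` \<A>)"
  shows "realizable r n (D + 2) (m + (card T + card \<A>)) ((\<lambda>A x. A \<in> level \<A> T (G x) (Suc k)) ` \<A>)"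
proof -
  let ?P = "\<lambda>A x. A \<in> level \<A> T (G x) k"
  let ?Q = "\<lambda>As x. set As \<subseteq> level \<A> T (G x) k"
  have "?Q As \<in> one_gate r (?P ` \<A>)" if "As \<in> T" for As
  proof -
    have "card (?P ` set As) < r"
      using T[OF that] card_image_le[of "set As" ?P] card_length[of As] by simp
    then have "(\<lambda>x. \<forall>g\<in>?P ` set As. g x) \<in> one_gate r (?P ` \<A>)"
      using T[OF that] by (intro one_gate.And) auto
    then show ?thesis by (simp add: subset_eq)
  qed
  then have "?Q ` T \<subseteq> one_gate r (?P ` \<A>)" by blast
  from realizable_layer[OF real _ this] fin(2)
  have ands: "realizable r n (Suc D) (m + card (?Q ` T)) (?P ` \<A> \<union> ?Q ` T)" by simp
  have "(\<lambda>x. A \<in> level \<A> T (G x) (Suc k)) \<in> one_gate r (?P ` \<A> \<union> ?Q ` T)" if A: "A \<in> \<A>" for A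
  proof -
    let ?J = "?P ` {B \<in> \<A>. B \<subseteq> A} \<union> ?Q ` {As \<in> T. \<Inter> (set As) = A}"
    have "card ?J \<le> card {B \<in> \<A>. B \<subseteq> A} + card {As \<in> T. \<Inter> (set As) = A}"
      using fin by (intro order_trans[OF card_Un_le] add_mono card_image_le) auto
    then have "(\<lambda>x. \<exists>g\<in>?J. g x) \<in> one_gate r (?P ` \<A> \<union> ?Q ` T)"
      using fin A r[OF A] by (intro one_gate.Or) auto
    moreover have "(\<lambda>x. \<exists>g\<in>?J. g x) = (\<lambda>x. A \<in> level \<A> T (G x) (Suc k))"
    proof
      fix x
      have "level \<A> T (G x) k \<subseteq> \<A>" using sub by (rule level_subset)
      then show "(\<exists>g\<in>?J. g x) = (A \<in> level \<A> T (G x) (Suc k))"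
        using A by (simp add: bex_Un) blast
    qed
    ultimately show ?thesis by simp
  qed
  then have sub': "(\<lambda>A x. A \<in> level \<A> T (G x) (Suc k)) ` \<A> \<subseteq> one_gate r (?P ` \<A> \<union> ?Q ` T)"
    by blast
  have "card (?Q ` T) \<le> card T" "card ((\<lambda>A x. A \<in> level \<A> T (G x) (Suc k)) ` \<A>) \<le> card \<A>"
    using fin by (simp_all only: card_image_le)
  \<comment> \<open>Only the functions of the new level are passed on; the gates of the older ones
    remain counted.\<close>
  then show ?thesis
    using realizable_subset[OF realizable_layer[OF ands finite_imageI[OF fin(1)] sub'] Un_upper2]
    by (simp del: level.simps)
qed

section \<open>Counting gates and assembling the circuit\<close>

lemma card_relevant_le:
  assumes "finite T" "\<And>As. As \<in> T \<Longrightarrow> length As = t"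
  shows "finite (relevant n f T)" "card (relevant n f T) \<le> card T * (t + 1) + 2 * n + 2"
proof -
  show "finite (relevant n f T)"
    using assms(1) by (auto simp: relevant_def literal_sets_def)
  have "card (literal_sets n f) \<le> card {..<n} + card {..<n}"
    unfolding literal_sets_def
    by (intro order_trans[OF card_Un_le] add_mono card_image_le) auto
  moreover have "card (\<Union>As\<in>T. set As) \<le> card T * t"
    using card_UN_le[OF assms(1), of set] sum_bounded_above[of T "\<lambda>As. card (set As)" t]
      assms(2) card_length by (fastforce intro: order_trans)
  moreover have "card ((\<lambda>As. \<Inter> (set As)) ` T) \<le> card T" by (rule card_image_le[OF assms(1)])
  moreover have "card {zeros n f, {}} \<le> 2" by (simp add: card_insert_if)
  \<comment> \<open>Each tuple contributes \<open>t\<close> components and one intersection, the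
    literals \<open>2 * n\<close> traces, and \<open>zeros n f\<close> and \<open>{}\<close> the
    final 2.\<close>
  moreover have "card (relevant n f T) \<le> card {zeros n f, {}} + card (literal_sets n f) +
      card (\<Union>As\<in>T. set As) + card ((\<lambda>As. \<Inter> (set As)) ` T)"
    unfolding relevant_def
    by (intro order_trans[OF card_Un_le] add_mono order_refl)
  ultimately show "card (relevant n f T) \<le> card T * (t + 1) + 2 * n + 2" by simp
qed

text \<open>The initial family costs depth 2, and so does each of the \<open>d - 1\<close> closing
  steps. Each of these \<open>d\<close> stages takes at most \<open>3 * (s * t + n)\<close>
  gates.\<close>

lemma covering_circuit:
  assumes d: "d \<ge> 2" and n: "n \<ge> 2" and t: "t \<ge> 2"
    and cov: "covering_set n f (all_semifilters n f (d - 1)) d t T" and s: "card T < s"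
  shows "\<exists>C. circuit_over (s * (t + 2) + 2 * n + 2) n C \<and> circuit_depth C \<le> 2 * d \<and>
    circuit_size C \<le> 3 * d * (s * t + n) \<and> computes n C f"
proof -
  define r where "r = s * (t + 2) + 2 * n + 2"
  define \<A> where "\<A> = relevant n f T"
  define T' where "T' = T \<union> clash_pairs n f"
  define G where "G x = level \<A> T' (initial n f x)" for x
  have fin: "finite T" and T: "\<And>As. As \<in> T \<Longrightarrow> length As = t \<and> set As \<subseteq> Pow (zeros n f)"
    using cov by (auto simp: covering_set_def)
  have T_ne: "As \<noteq> [] \<and> set As \<subseteq> Pow (zeros n f)" if "As \<in> T" for As
    using T[OF that] t by auto
  have fin\<A>: "finite \<A>" and card\<A>: "card \<A> \<le> card T * (t + 1) + 2 * n + 2"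
    unfolding \<A>_def using card_relevant_le[OF fin] T by blast+
  have pairs: "finite (clash_pairs n f)" "card (clash_pairs n f) \<le> n"
    using card_image_le[of "{..<n}" "\<lambda>i. [trace n f (\<lambda>x. x ! i), trace n f (\<lambda>x. \<not> x ! i)]"]
    by (auto simp: clash_pairs_def)
  have pair_Int: "\<Inter> (set As) = {}" if "As \<in> clash_pairs n f" for As
    using that by (auto simp: clash_pairs_def trace_def ones_def)
  have cardT': "card T' \<le> card T + n"
    using card_Un_le[of T "clash_pairs n f"] pairs by (simp add: T'_def)
  \<comment> \<open>Since \<open>card T < s\<close>, the arity bound leaves \<open>t + 2\<close> to
    spare. This pays for the strict inequality \<open>card J < r\<close> required by
    \<open>one_gate\<close>.\<close>
  obtain s' where s': "s = Suc s'" "card T \<le> s'" using s by (cases s) auto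
  have "card T * (t + 2) \<le> s' * (t + 2)" using s'(2) by (rule mult_le_mono1)
  then have r_bound: "card T * (t + 2) + 2 * n + 2 + (t + 2) \<le> r"
    by (simp add: r_def s')
  \<comment> \<open>The \<open>n\<close> additional pairs would exceed the allowed fan-in, but they intersect in \<open>{}\<close>, and
    the gate for \<open>{}\<close> reads no other subset.\<close>
  have fan_in: "card {B \<in> \<A>. B \<subseteq> A} + card {As \<in> T'. \<Inter> (set As) = A} < r" if "A \<in> \<A>" for A
  proof (cases "A = {}")
    case True
    have "{B \<in> \<A>. B \<subseteq> A} \<subseteq> {{}}" using True by auto
    from card_mono[OF _ this] have "card {B \<in> \<A>. B \<subseteq> A} \<le> 1" by simp
    moreover have "card {As \<in> T'. \<Inter> (set As) = A} \<le> card T'"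
      using fin pairs by (intro card_mono) (auto simp: T'_def)
    moreover have "card T \<le> card T * (t + 2)" by simp
    ultimately show ?thesis using cardT' r_bound by linarith
  next
    case False
    then have "{As \<in> T'. \<Inter> (set As) = A} \<subseteq> T" using pair_Int by (auto simp: T'_def)
    then have "card {As \<in> T'. \<Inter> (set As) = A} \<le> card T" using fin card_mono by blast
    moreover have "card {B \<in> \<A>. B \<subseteq> A} \<le> card \<A>" using fin\<A> by (intro card_mono) auto
    ultimately show ?thesis using card\<A> r_bound by (simp add: algebra_simps)
  qed
  have T': "As \<noteq> [] \<and> length As < r \<and> set As \<subseteq> \<A>" if "As \<in> T'" for As
  proof (cases "As \<in> T")
    case True
    moreover have "t < r" using r_bound by simp
    moreover have "set As \<subseteq> \<A>" using True by (auto simp: \<A>_def relevant_def)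
    ultimately show ?thesis using T T_ne by simp
  next
    case False
    then obtain i where "i < n" "As = [trace n f (\<lambda>x. x ! i), trace n f (\<lambda>x. \<not> x ! i)]"
      using \<open>As \<in> T'\<close> by (auto simp: T'_def clash_pairs_def)
    moreover have "2 < r" using r_bound t by simp
    ultimately show ?thesis by (simp add: \<A>_def relevant_def literal_sets_def)
  qed
  have levels: "realizable r n (2 + 2 * k) (n + card \<A> + k * (card T' + card \<A>))
      ((\<lambda>A x. A \<in> G x k) ` \<A>)" for k
  proof (induction k)
    case 0
    show ?case
      using realizable_initial[OF _ _ fin\<A>, of n r f] n r_bound t by (simp add: G_def)
  next
    case (Suc k)
    have "finite T'" using fin pairs by (simp add: T'_def)
    from fin\<A> this T' fan_in
    have "realizable r n (2 + 2 * k + 2) (n + card \<A> + k * (card T' + card \<A>) + (card T' + card \<A>))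
        ((\<lambda>A x. A \<in> level \<A> T' (initial n f x) (Suc k)) ` \<A>)"
    proof (rule realizable_level_Suc)
      show "initial n f x \<subseteq> \<A>" for x unfolding \<A>_def by (rule initial_subset)
    qed (use Suc in \<open>simp_all only: G_def\<close>)
    then show ?case by (simp only: G_def mult_Suc mult_Suc_right add_ac)
  qed
  have eval: "({} \<in> G x (d - 1)) = f x" if x: "x \<in> cube n" for x
  proof (cases "f x")
    case True
    \<comment> \<open>A rejected 1-input would yield a semifilter that no tuple of \<open>T\<close>
      covers. The clash pairs shape the levels but are no part of the covering set.\<close>
    have False if empty: "{} \<notin> G x (d - 1)"
    proof -
      have "x \<in> ones n f" using x True by (simp add: ones_def)
      moreover have "1 \<le> d - 1" using d by simp
      ultimately obtain F where "F \<in> all_semifilters n f (d - 1)"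
        "\<forall>k\<in>{1..d - 1}. \<forall>As\<in>T. preserves k F As"
        using uncovered_semifilter[OF T_ne _ _ empty[unfolded G_def \<A>_def T'_def]] by blast
      with cov show False unfolding covering_set_def covers_def by fastforce
    qed
    with True show ?thesis by blast
  next
    case False
    then have "x \<in> zeros n f" using x by (simp add: zeros_def)
    with level_point[of "initial n f x" x "{}" \<A> T' "d - 1"] False show ?thesis
      using initial_point unfolding G_def by blast
  qed
  have "(\<lambda>x. {} \<in> G x (d - 1)) \<in> (\<lambda>A x. A \<in> G x (d - 1)) ` \<A>"
    by (rule image_eqI[of _ _ "{}"]) (simp_all add: \<A>_def relevant_def)
  from realizable_circuit[OF levels this eval]
  obtain C where C: "circuit_over r n C" "circuit_depth C \<le> 2 + 2 * (d - 1)"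
    "circuit_size C \<le> n + card \<A> + (d - 1) * (card T' + card \<A>)" "computes n C f" by blast
  \<comment> \<open>With \<open>s' \<le> p\<close> and \<open>2 \<le> t\<close>, the bound
    \<open>p + s' + 2 * n + 2\<close> on \<open>card \<A>\<close> is at most \<open>2 * ?M\<close>.
    A further \<open>?M\<close> absorbs \<open>n\<close> or \<open>card T'\<close>, whence the
    constant 3.\<close>
  let ?M = "s * t + n"
  define p where "p = s' * t"
  have le: "s' \<le> p" using t by (simp add: p_def)
  have M: "?M = p + t + n" by (simp add: s'(1) p_def)
  have "card T * (t + 1) \<le> p + s'"
    using mult_le_mono1[OF s'(2), of "t + 1"] by (simp add: p_def)
  then have "card \<A> \<le> p + s' + 2 * n + 2" using card\<A> by (meson add_le_mono1 order_trans)
  then have "card \<A> \<le> 2 * ?M" using le t unfolding M by simp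
  moreover have "card T' \<le> ?M" using le cardT' s'(2) unfolding M by linarith
  ultimately have "n + card \<A> \<le> 3 * ?M" "card T' + card \<A> \<le> 3 * ?M" by simp_all
  then have "n + card \<A> + (d - 1) * (card T' + card \<A>) \<le> 3 * ?M + (d - 1) * (3 * ?M)"
    by (intro add_mono mult_le_mono2)
  also have "\<dots> = 3 * d * ?M" using d by (cases d) (simp_all add: algebra_simps)
  finally show ?thesis using C d by (intro exI[of _ C]) (auto simp: r_def)
qed

section \<open>From the absence of small circuits to the bound on \<open>rho\<close>\<close>

theorem theorem8:
  "\<exists>K::real. K > 0 \<and>
     (\<forall>(n::nat) (d::nat) (t::nat) (s::nat) (f :: bool list \<Rightarrow> bool).
        d \<ge> 2 \<longrightarrow> n \<ge> 2 \<longrightarrow> t \<ge> 2 \<longrightarrow> s \<ge> 1 \<longrightarrow>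
        \<not> (\<exists>C. circuit_over (s * (t + 2) + 2 * n + 2) n C \<and>
               circuit_depth C \<le> 2 * d + 1 \<and>
               real (circuit_size C) \<le> K * real d * (real s * real t + real n)^2 \<and>
               computes n C f) \<longrightarrow>
        rho n f (all_semifilters n f (d - 1)) d t \<ge> enat s)"
proof (intro exI[of _ 3] conjI allI impI)
  fix n d t s :: nat and f :: "bool list \<Rightarrow> bool"
  assume d: "d \<ge> 2" and n: "n \<ge> 2" and t: "t \<ge> 2"
    and no_circuit: "\<not> (\<exists>C. circuit_over (s * (t + 2) + 2 * n + 2) n C \<and>
      circuit_depth C \<le> 2 * d + 1 \<and>
      real (circuit_size C) \<le> 3 * real d * (real s * real t + real n)^2 \<and> computes n C f)"
  show "enat s \<le> rho n f (all_semifilters n f (d - 1)) d t"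
  proof (rule ccontr)
    assume "\<not> enat s \<le> rho n f (all_semifilters n f (d - 1)) d t"
    \<comment> \<open>An infimum below \<open>enat s\<close> is undercut by the size of an actual
      covering set, so the value \<open>\<infinity>\<close> causes no trouble.\<close>
    then obtain T where "covering_set n f (all_semifilters n f (d - 1)) d t T" "card T < s"
      by (auto simp: rho_def not_le Inf_less_iff)
    from covering_circuit[OF d n t this] obtain C where
      C: "circuit_over (s * (t + 2) + 2 * n + 2) n C" "circuit_depth C \<le> 2 * d"
      "circuit_size C \<le> 3 * d * (s * t + n)" "computes n C f"
      by blast
    \<comment> \<open>The constructed circuit has size linear in \<open>s * t + n\<close>; passing
      to the square keeps the constant 3.\<close>
    have "s * t + n \<le> (s * t + n)^2" unfolding power2_eq_square by (rule le_square)
    then have "circuit_size C \<le> 3 * d * (s * t + n)^2"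
      using C(3) by (meson mult_le_mono2 order_trans)
    then have "real (circuit_size C) \<le> real (3 * d * (s * t + n)^2)" by (rule of_nat_mono)
    also have "\<dots> = 3 * real d * (real s * real t + real n)^2" by simp
    finally show False using no_circuit C by fastforce
  qed
qed simp

end
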